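(* Let $\phi=(1+\sqrt5)/2$ and, for $n\ge 0$, let $A_n=\lfloor \phi n\rfloor$ and $B_n=\lfloor \phi^2 n\rfloor$. For every integer $k\ge 0$, the set of positions with nim-value $1$ in the game $\mathcal{T}_k$ is $$\{(0,1)\}\cup\{(A_n+2,\,B_n+2)\mid n\ge 0\}.$$
   Context: For an integer $k\ge 0$, $\mathcal{T}_k$ is the following two-player game. A position is a pair $(a,b)$ of nonnegative integers (sizes of two piles of tokens); the piles are unordered, so $(a,b)$ and $(b,a)$ are identified, and a listed set of positions is understood up to this symmetry. Players alternate; a player who cannot move loses. From a position $(a,b)$ with $a\le b$, each move is one of: (i) remove a positive number of tokens from a single pile; (ii) remove an equal positive number $s$ of tokens from both piles, provided that $a-s>0$ and $\left|\left\lfloor \frac{b-s}{a-s}\right\rfloor-\left\lfloor\frac{b}{a}\right\rfloor\right|\le k$. The nim-value (Sprague-Grundy value) of a position is defined recursively as the least nonnegative integer that is not the nim-value of any position reachable from it in one move (so a terminal position has nim-value $0$). *)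

theory Defs
  imports Complex_Main "HOL-Library.Uprod"
begin

lift_definition tokens :: "nat uprod \<Rightarrow> nat" is "\<lambda>(a, b). a + b"
  by auto

lemma tokens_Upair [simp]: "tokens (Upair a b) = a + b"
  by transfer simp

text \<open>
  Rule \<open>single\<close> covers removal from either pile, since \<open>Upair a b = Upair b a\<close>.
  In rule \<open>both\<close> we have \<open>s < a \<le> b\<close>, so the natural-number subtractions do not truncate
  and the denominators are positive.
\<close>

inductive move :: "nat \<Rightarrow> nat uprod \<Rightarrow> nat uprod \<Rightarrow> bool" for k :: nat where
  single: "0 < s \<Longrightarrow> s \<le> b \<Longrightarrow> move k (Upair a b) (Upair a (b - s))"
| both: "a \<le> b \<Longrightarrow> 0 < s \<Longrightarrow> s < a \<Longrightarrow>
    \<bar>\<lfloor>real (b - s) / real (a - s)\<rfloor> - \<lfloor>real b / real a\<rfloor>\<bar> \<le> int k \<Longrightarrow>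
    move k (Upair a b) (Upair (a - s) (b - s))"

lemma tokens_move: "move k p q \<Longrightarrow> tokens q < tokens p"
  by (induction rule: move.induct) auto

lemma finite_moves: "finite {q. move k p q}"
proof -
  have "{q. move k p q} \<subseteq> case_prod Upair ` ({..tokens p} \<times> {..tokens p})"
  proof
    fix q assume "q \<in> {q. move k p q}"
    then have "tokens q < tokens p" by (simp add: tokens_move)
    then show "q \<in> case_prod Upair ` ({..tokens p} \<times> {..tokens p})"
      by (cases q) force
  qed
  then show ?thesis by (rule finite_subset) simp
qed

definition mex :: "nat set \<Rightarrow> nat" where
  "mex S = (LEAST v. v \<notin> S)"

function nim_value :: "nat \<Rightarrow> nat uprod \<Rightarrow> nat" where
  "nim_value k p = mex (nim_value k ` {q. move k p q})"
  by auto
termination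
  by (relation "measure (\<lambda>(k, p). tokens p)") (auto dest: tokens_move)

declare nim_value.simps [simp del]

definition \<phi> :: real where
  "\<phi> = (1 + sqrt 5) / 2"

definition A :: "nat \<Rightarrow> nat" where
  "A n = nat \<lfloor>\<phi> * real n\<rfloor>"

definition B :: "nat \<Rightarrow> nat" where
  "B n = nat \<lfloor>\<phi>\<^sup>2 * real n\<rfloor>"

end

theory Submission
  imports Defs
begin

text \<open>
  The pairs \<open>(A n, B n)\<close> are the losing positions of Wythoff's game, in which one may remove tokens
  from one pile, or equally many from both. Translate them by \<open>c \<ge> 1\<close> along the diagonal. In
  \<open>\<T>\<^sub>k\<close>, no move joins two translated pairs, since such a move would already be a move
  between losing positions of Wythoff's game. Conversely, from every other position whose piles
  both have at least \<open>c\<close> tokens, Wythoff's strategy reaches a translated pair, and it stays legal: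
  a diagonal move in it ends in a pair whose ratio has integer part \<open>1\<close>, and adding the same
  number to both piles keeps the integer part \<open>1\<close>. This is why the answer is independent of \<open>k\<close>.

  It remains to treat the positions with a pile smaller than \<open>c\<close>. A diagonal move never empties a
  pile. For \<open>c = 1\<close> these positions are the \<open>(0, b)\<close>, and adding \<open>(0, 0)\<close> to the translated pairs
  provides for them; this gives the nim-value \<open>0\<close>. For \<open>c = 2\<close> they are the \<open>(0, b)\<close> and \<open>(1, b)\<close>,
  and adding \<open>(0, 1)\<close> provides for all of them except \<open>(0, 0)\<close> and \<open>(1, 1)\<close>, whose nim-value is \<open>0\<close>.
  The two sets are disjoint, as a pair is determined by the difference of its piles, and so the
  second set is the set of positions of nim-value \<open>1\<close>.

  The lemma \<open>nim_value_level_setI\<close> is the principle by which a level set of the nim-value is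
  recognised, and \<open>no_move_wythoff\<close> and \<open>move_to_wythoff\<close> are the two facts about translated pairs.
  The latter rests on the theorem of Beatty for \<open>1/\<phi> + 1/\<phi>\<^sup>2 = 1\<close>: the positive values of \<open>A\<close> and
  \<open>B\<close> partition the positive integers.
\<close>

section \<open>Level sets of the nim-value\<close>

lemma mex_notin: "finite S \<Longrightarrow> mex S \<notin> S"
  unfolding mex_def by (rule LeastI_ex) (rule ex_new_if_finite[OF infinite_UNIV_nat])

lemma less_mex_in: "v < mex S \<Longrightarrow> v \<in> S"
  unfolding mex_def using not_less_Least by blast

lemma nim_value_move_neq: "move k p q \<Longrightarrow> nim_value k q \<noteq> nim_value k p"
  using mex_notin[OF finite_imageI[OF finite_moves[of k p]], of "nim_value k"]
  unfolding nim_value.simps[of k p, symmetric] by (metis image_eqI mem_Collect_eq)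

lemma less_nim_value_move: "v < nim_value k p \<Longrightarrow> \<exists>q. move k p q \<and> nim_value k q = v"
  using less_mex_in[of v "nim_value k ` {q. move k p q}"]
  unfolding nim_value.simps[of k p, symmetric] by blast

text \<open>
  This is the usual characterisation of losing positions as a kernel, relative to the positions
  that remain once those of nim-value less than \<open>v\<close> have been discarded.
\<close>

lemma nim_value_level_setI:
  assumes lower: "\<And>p. p \<in> P \<Longrightarrow> v \<le> nim_value k p"
    and independent: "\<And>p q. p \<in> P \<Longrightarrow> move k p q \<Longrightarrow> q \<notin> P"
    and absorbing: "\<And>p. p \<notin> P \<Longrightarrow> v \<le> nim_value k p \<Longrightarrow> \<exists>q\<in>P. move k p q"
  shows "{p. nim_value k p = v} = P"
proof -
  have "nim_value k p = v \<longleftrightarrow> p \<in> P" for p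
  proof (induction "tokens p" arbitrary: p rule: less_induct)
    case less
    then have IH: "nim_value k q = v \<longleftrightarrow> q \<in> P" if "move k p q" for q
      using that tokens_move by blast
    show ?case
    proof (cases "p \<in> P")
      case True
      have "\<not> v < nim_value k p"
        using less_nim_value_move[of v k p] independent[OF True] IH by blast
      with lower[OF True] True show ?thesis by simp
    next
      case False
      then show ?thesis
        using absorbing[OF False] IH nim_value_move_neq[of k p] by fastforce
    qed
  qed
  then show ?thesis by blast
qed

section \<open>Beatty's theorem for the golden ratio\<close>

lemma phi_bounds: "1 < \<phi>" "\<phi> < 2"
proof -
  have "sqrt 5 < (3::real)" by (rule real_less_lsqrt) auto
  moreover have "1 < sqrt (5::real)" by simp
  ultimately show "1 < \<phi>" "\<phi> < 2" by (simp_all add: \<phi>_def)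
qed

lemma phi_square: "\<phi>\<^sup>2 = \<phi> + 1"
  by (simp add: \<phi>_def power2_eq_square field_simps)

lemma B_eq: "B n = A n + n"
proof -
  have "\<phi>\<^sup>2 * real n = \<phi> * real n + real_of_int (int n)"
    by (simp add: phi_square algebra_simps)
  then have "\<lfloor>\<phi>\<^sup>2 * real n\<rfloor> = \<lfloor>\<phi> * real n\<rfloor> + int n"
    by (metis floor_add_int)
  then show ?thesis
    using phi_bounds by (simp add: A_def B_def nat_add_distrib)
qed

lemma A_eq_iff: "A n = m \<longleftrightarrow> real m \<le> \<phi> * real n \<and> \<phi> * real n < real m + 1"
proof -
  have "0 \<le> \<phi> * real n" using phi_bounds by simp
  then have "A n = m \<longleftrightarrow> \<lfloor>\<phi> * real n\<rfloor> = int m"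
    unfolding A_def by (metis nat_int nat_0_le zero_le_floor)
  then show ?thesis by (simp add: floor_eq_iff)
qed

lemma A_0 [simp]: "A 0 = 0"
  by (simp add: A_def)

lemma strict_mono_A: "strict_mono A"
unfolding strict_mono_Suc_iff
proof
  fix n
  have "\<phi> * real (Suc n) = \<phi> * real n + \<phi>" by (simp add: algebra_simps)
  then show "A n < A (Suc n)"
    using A_eq_iff[of n "A n"] A_eq_iff[of "Suc n" "A (Suc n)"] phi_bounds by simp
qed

lemma A_eq_A_iff [simp]: "A n = A m \<longleftrightarrow> n = m"
  by (rule strict_mono_eq[OF strict_mono_A])

lemma strict_mono_B: "strict_mono B"
  using strict_mono_A by (simp add: B_eq strict_mono_def add_less_mono)

lemma B_eq_B_iff [simp]: "B n = B m \<longleftrightarrow> n = m"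
  by (rule strict_mono_eq[OF strict_mono_B])

lemma le_A: "n \<le> A n"
  by (rule strict_mono_imp_increasing[OF strict_mono_A])

text \<open>
  Infinite descent: if \<open>j = \<phi> n\<close>, then \<open>n = \<phi> (j - n)\<close>, with \<open>j - n < n\<close> because \<open>\<phi> < 2\<close>.
\<close>

lemma phi_irrational: "real j = \<phi> * real n \<Longrightarrow> n = 0"
proof (induction n arbitrary: j rule: less_induct)
  case (less n)
  show ?case
  proof (rule ccontr)
    assume "n \<noteq> 0"
    then have bounds: "real n < real j" "real j < 2 * real n"
      using phi_bounds less.prems by simp_all
    have "real (j - n) = real j - real n"
      using bounds by (intro of_nat_diff) simp
    moreover have "\<phi> * (real j - real n) = (\<phi>\<^sup>2 - \<phi>) * real n"
      using less.prems by (simp add: power2_eq_square algebra_simps)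
    ultimately have "real n = \<phi> * real (j - n)"
      by (simp only: phi_square add_diff_cancel_left' mult_1)
    then have "j - n = 0"
      using bounds by (intro less.IH) auto
    with bounds show False by simp
  qed
qed

text \<open>
  The bounds \<open>r \<le> \<phi> m < r + 1\<close> that say \<open>A m = r\<close>, multiplied by \<open>1/\<phi> = \<phi> - 1\<close>. They locate
  \<open>B m = r + m\<close> strictly inside the gap between \<open>A r\<close> and \<open>A (r + 1)\<close>, apart from the case
  \<open>\<phi> r = r + m\<close>, which irrationality confines to \<open>r = 0\<close>.
\<close>

lemma A_eq_iff_dual:
  "A m = r \<longleftrightarrow> \<phi> * real r \<le> real r + real m \<and> real r + real m + 1 < \<phi> * (real r + 1)"
proof -
  have inv: "(\<phi> - 1) * (\<phi> * x) = x" for x :: real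
    using phi_square by (simp add: power2_eq_square algebra_simps flip: mult.assoc)
  have pos: "0 < \<phi> - 1" using phi_bounds by simp
  have "real r \<le> \<phi> * real m \<longleftrightarrow> (\<phi> - 1) * real r \<le> real m"
    using mult_le_cancel_left_pos[OF pos, of "real r" "\<phi> * real m"] by (simp only: inv)
  moreover have "\<phi> * real m < real r + 1 \<longleftrightarrow> real m < (\<phi> - 1) * (real r + 1)"
    using mult_less_cancel_left_pos[OF pos, of "\<phi> * real m" "real r + 1"] by (simp only: inv)
  ultimately show ?thesis
    unfolding A_eq_iff by (auto simp: algebra_simps)
qed

lemma A_eq_B_imp_0:
  assumes "A n = B m"
  shows "n = 0 \<and> m = 0"
proof -
  define r where "r = A m"
  have n: "real r + real m \<le> \<phi> * real n" "\<phi> * real n < real r + real m + 1"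
    using A_eq_iff[of n "r + m"] assms by (simp_all add: r_def B_eq)
  have m: "\<phi> * real r \<le> real r + real m" "real r + real m + 1 < \<phi> * (real r + 1)"
    using A_eq_iff_dual[of m r] by (simp_all add: r_def)
  have "\<phi> * real r \<le> \<phi> * real n" "\<phi> * real n < \<phi> * (real r + 1)"
    using m n by linarith+
  then have "n = r" using phi_bounds by simp
  then have "real (r + m) = \<phi> * real r" using m n by simp
  then have "r = 0" by (rule phi_irrational)
  then show ?thesis using \<open>n = r\<close> le_A[of m] by (simp add: r_def)
qed

text \<open>
  The last value \<open>A r\<close> not exceeding \<open>j\<close> is either \<open>j\<close> itself or followed by a gap that
  contains \<open>j\<close>; in the gap lies \<open>B (j - r)\<close>, which must be \<open>j\<close>.
\<close>

lemma A_or_B: "(\<exists>n. j = A n) \<or> (\<exists>n. j = B n)"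
proof -
  obtain r where r: "A r \<le> j" "\<And>r'. A r' \<le> j \<Longrightarrow> r' \<le> r"
    using ex_has_greatest_nat[of "\<lambda>r. A r \<le> j" 0 id j] le_A order_trans by fastforce
  show ?thesis
  proof (cases "A r = j")
    case False
    then have "A r < j" using r by simp
    then have "real (A r) + 1 \<le> real j" by linarith
    then have low: "\<phi> * real r < real j" using A_eq_iff[of r "A r"] by simp
    have "j < A (r + 1)" using r(2)[of "r + 1"] by linarith
    then have "real j + 1 \<le> real (A (r + 1))" by linarith
    then have "real j + 1 \<le> \<phi> * (real r + 1)"
      using A_eq_iff[of "r + 1" "A (r + 1)"] by (simp add: add.commute)
    moreover have "real j + 1 \<noteq> \<phi> * (real r + 1)"
      using phi_irrational[of "j + 1" "r + 1"] by (auto simp: add.commute)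
    moreover have "r \<le> j" using le_A[of r] r by simp
    ultimately have "A (j - r) = r"
      using low by (subst A_eq_iff_dual) (simp add: of_nat_diff)
    then have "j = B (j - r)" using \<open>r \<le> j\<close> by (simp add: B_eq)
    then show ?thesis by blast
  qed blast
qed

section \<open>Translated Wythoff pairs\<close>

definition wythoff :: "nat \<Rightarrow> nat uprod set" where
  "wythoff c = {Upair (A n + c) (B n + c) | n. True}"

lemma wythoffI: "Upair (A n + c) (B n + c) \<in> wythoff c" "Upair (B n + c) (A n + c) \<in> wythoff c"
  by (auto simp: wythoff_def)

text \<open>
  A move to another pair would keep either one pile or the difference \<open>n\<close> of the piles; each of
  these determines the pair.
\<close>

lemma no_move_wythoff:
  assumes "p \<in> wythoff c" "move k p q"
  shows "q \<notin> wythoff c"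
proof
  assume "q \<in> wythoff c"
  then obtain m where q: "q = Upair (A m + c) (B m + c)" by (auto simp: wythoff_def)
  from assms obtain n where p: "p = Upair (A n + c) (B n + c)" by (auto simp: wythoff_def)
  from \<open>move k p q\<close> have "n = m"
  proof cases
    case (single s b a)
    then have "a = A n + c \<or> a = B n + c" "a = A m + c \<or> a = B m + c"
      using p q by auto
    then show ?thesis
      using A_eq_B_imp_0[of n m] A_eq_B_imp_0[of m n] by auto
  next
    case (both a b s)
    then have "b - a = n" using p by (auto simp: B_eq)
    moreover from both have "(b - s) - (a - s) = m" using q by (auto simp: B_eq)
    ultimately show ?thesis using both by simp
  qed
  with p q tokens_move[OF \<open>move k p q\<close>] show False by simp
qed

lemma floor_divide_eq_1: "0 < a \<Longrightarrow> a \<le> b \<Longrightarrow> b < 2 * a \<Longrightarrow> \<lfloor>real b / real a\<rfloor> = 1"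
  by (simp add: floor_eq_iff field_simps)

text \<open>
  Wythoff's strategy. If the smaller pile is some \<open>B n + c\<close>, the larger one is cut down to
  \<open>A n + c\<close>. If it is \<open>A n + c\<close>, the larger one is cut down to \<open>B n + c\<close>, when it exceeds that;
  otherwise the difference \<open>d\<close> of the piles is less than \<open>n\<close>, and the diagonal move to the pair of
  difference \<open>d\<close> is possible. Here \<open>c > 0\<close> ensures that the latter leaves no pile empty, and that
  the ratio of the new piles is less than \<open>2\<close> even when \<open>A d = d\<close>, that is, for \<open>d \<le> 1\<close>.
\<close>

lemma move_to_wythoff:
  assumes "0 < c" "c \<le> a" "c \<le> b" "Upair a b \<notin> wythoff c"
  shows "\<exists>q\<in>wythoff c. move k (Upair a b) q"
proof -
  have ordered: "\<exists>q\<in>wythoff c. move k (Upair a b) q"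
    if "c \<le> a" "a \<le> b" "Upair a b \<notin> wythoff c" for a b
  proof -
    have reduce: "move k (Upair a b) (Upair a b')" if "b' < b" for b'
      using move.single[of "b - b'" b k a] that by simp
    from A_or_B[of "a - c"] show ?thesis
    proof (elim disjE exE)
      fix n assume "a - c = B n"
      then have a: "a = B n + c" using \<open>c \<le> a\<close> by simp
      then have "A n + c \<noteq> b" using that wythoffI[of n c] by auto
      then have "A n + c < b" using a \<open>a \<le> b\<close> by (simp add: B_eq)
      from reduce[OF this] show ?thesis using wythoffI a by blast
    next
      fix n assume "a - c = A n"
      then have a: "a = A n + c" using \<open>c \<le> a\<close> by simp
      then have "b \<noteq> B n + c" using that wythoffI[of n c] by auto
      then consider "B n + c < b" | "b < B n + c" by linarith
      then show ?thesis
      proof cases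
        case 1
        from reduce[OF this] show ?thesis using wythoffI a by blast
      next
        case 2
        define d where "d = b - a"
        define s where "s = A n - A d"
        have b: "b = a + d" using \<open>a \<le> b\<close> by (simp add: d_def)
        then have "d < n" using 2 a by (simp add: B_eq)
        then have "A d < A n" using strict_mono_A by (simp add: strict_mono_less)
        then have s: "0 < s" "s < a" "a - s = A d + c" "b - s = B d + c"
          using a b \<open>0 < c\<close> by (simp_all add: s_def B_eq)
        have "\<lfloor>real b / real a\<rfloor> = 1"
          using s le_A[of d] b \<open>0 < c\<close> by (intro floor_divide_eq_1) auto
        moreover have "\<lfloor>real (b - s) / real (a - s)\<rfloor> = 1"
          unfolding s using le_A[of d] \<open>0 < c\<close> by (intro floor_divide_eq_1) (auto simp: B_eq)
        ultimately have "move k (Upair a b) (Upair (a - s) (b - s))"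
          using s \<open>a \<le> b\<close> by (intro move.both) auto
        then show ?thesis unfolding s using wythoffI by blast
      qed
    qed
  qed
  show ?thesis
  proof (cases "a \<le> b")
    case True
    with ordered assms show ?thesis by blast
  next
    case False
    have swap: "Upair a b = Upair b a" by simp
    show ?thesis
      using False assms unfolding swap by (intro ordered) linarith+
  qed
qed

lemma wythoff_disjoint: "c \<noteq> c' \<Longrightarrow> wythoff c \<inter> wythoff c' = {}"
proof (rule ccontr)
  assume "c \<noteq> c'" "wythoff c \<inter> wythoff c' \<noteq> {}"
  then obtain p where "p \<in> wythoff c" "p \<in> wythoff c'" by blast
  then obtain n m where "Upair (A n + c) (B n + c) = Upair (A m + c') (B m + c')"
    unfolding wythoff_def by blast
  moreover from this have "n = m" by (auto simp: B_eq)
  ultimately show False using \<open>c \<noteq> c'\<close> by auto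
qed

lemma wythoff_ge: "Upair a b \<in> wythoff c \<Longrightarrow> c \<le> a \<and> c \<le> b"
  by (auto simp: wythoff_def)

text \<open>A single move cannot bring both piles down below \<open>c\<close>, and a diagonal move empties neither.\<close>

lemma not_move_wythoff_empty_pile:
  assumes "p \<in> wythoff c" "i < c"
  shows "\<not> move k p (Upair 0 i)"
proof
  assume "move k p (Upair 0 i)"
  then show False
  proof cases
    case (single s b a)
    with assms wythoff_ge[of a b c] show False by auto
  qed auto
qed

lemma move_pile: "b' < b \<Longrightarrow> move k (Upair a b) (Upair a b')"
  using move.single[of "b - b'" b k a] by simp

section \<open>Nim-values 0 and 1\<close>

lemma uprod_ordered_cases:
  obtains a b :: nat where "p = Upair a b" "a \<le> b"
proof -
  obtain a b where p: "p = Upair a b" by (cases p)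
  then have "p = Upair b a" by simp
  with p show thesis using that[of a b] that[of b a] by linarith
qed

lemma not_move_from_small: "move k (Upair 0 i) q \<Longrightarrow> i \<le> 1 \<Longrightarrow> q = Upair 0 0"
  by (erule move.cases) auto

theorem nim_value_0: "{p. nim_value k p = 0} = {Upair 0 0} \<union> wythoff 1"
proof (rule nim_value_level_setI)
  fix p q assume "p \<in> {Upair 0 0} \<union> wythoff 1" "move k p q"
  then show "q \<notin> {Upair 0 0} \<union> wythoff 1"
    using no_move_wythoff[of p 1 k q] not_move_wythoff_empty_pile[of p 1 0 k]
      tokens_move[of k p q] by auto
next
  fix p assume p: "p \<notin> {Upair 0 0} \<union> wythoff 1"
  obtain a b where ab: "p = Upair a b" "a \<le> b" by (rule uprod_ordered_cases)
  show "\<exists>q\<in>{Upair 0 0} \<union> wythoff 1. move k p q"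
  proof (cases "a = 0")
    case True
    then show ?thesis using p ab move_pile[of 0 b k 0] by auto
  next
    case False
    then show ?thesis using p ab move_to_wythoff[of 1 a b k] by auto
  qed
qed simp

theorem theorem13:
  fixes k :: nat
  shows "{p. nim_value k p = 1} = {Upair 0 1} \<union> {Upair (A n + 2) (B n + 2) | n. True}"
  unfolding wythoff_def[of 2, symmetric]
proof (rule nim_value_level_setI)
  fix p assume "p \<in> {Upair 0 1} \<union> wythoff 2"
  then have "p \<notin> {Upair 0 0} \<union> wythoff 1"
    using wythoff_disjoint[of 1 2] wythoff_ge[of 0 1 1] wythoff_ge[of 0 0 2] by auto
  then show "1 \<le> nim_value k p"
    using nim_value_0[of k] by (metis (mono_tags) less_one linorder_not_less mem_Collect_eq)
next
  fix p q assume "p \<in> {Upair 0 1} \<union> wythoff 2" "move k p q"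
  then show "q \<notin> {Upair 0 1} \<union> wythoff 2"
    using no_move_wythoff[of p 2 k q] not_move_wythoff_empty_pile[of p 2 1 k]
      not_move_from_small[of k 1 q] wythoff_ge[of 0 0 2] by auto
next
  fix p assume p: "p \<notin> {Upair 0 1} \<union> wythoff 2" "1 \<le> nim_value k p"
  obtain a b where ab: "p = Upair a b" "a \<le> b" by (rule uprod_ordered_cases)
  have nonzero: "p \<notin> {Upair 0 0} \<union> wythoff 1"
    using p nim_value_0[of k] by (metis (mono_tags) mem_Collect_eq not_one_le_zero)
  consider "a = 0" | "a = 1" | "2 \<le> a" by linarith
  then show "\<exists>q\<in>{Upair 0 1} \<union> wythoff 2. move k p q"
  proof cases
    case 1
    with p ab nonzero have "1 < b" by (cases "b = 0"; cases "b = 1") auto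
    with 1 ab show ?thesis using move_pile[of 1 b k 0] by auto
  next
    case 2
    \<comment> \<open>The larger pile is emptied: \<open>(1, b)\<close> goes to \<open>(1, 0)\<close>.\<close>
    with ab have "move k p (Upair 1 0)" using move_pile[of 0 b k 1] by simp
    then show ?thesis by (metis Upair_inject UnI1 singletonI)
  next
    case 3
    with p ab show ?thesis using move_to_wythoff[of 2 a b k] by auto
  qed
qed

end
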